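(* Let $U_{\mathrm{bh}}$ be an $n$-qubit unitary, let $A$ and $D$ be subsystems of the $n$ qubits, and let $d_A=2^{n_A}$ where $n_A$ is the number of qubits in $A$. If $$\mathbb{E}_{P_A,P_D}\big|\mathrm{OTOC}(U_{\mathrm{bh}})\big|=\mathbb{E}_{P_A,P_D}\mathrm{OTOC}(U_{\mathrm{bh}})+\eta ,$$ where $\eta>0$, then the decoding fidelity $F(U_{\mathrm{bh}})$ is bounded by the OTOC magic $O_M(U_{\mathrm{bh}})$ of $U_{\mathrm{bh}}$: $$F(U_{\mathrm{bh}})\le\frac{1}{d_A^2\,\big(1-O_M(U_{\mathrm{bh}})-\eta\big)} .$$
   Context: $n$-qubit Pauli operators are $n$-fold tensor products of single-qubit operators from $\{I,X,Y,Z\}$; the set of these is $\mathcal{P}_2^{\otimes n}$. For a $2^n\times2^n$ matrix $M$, $\langle M\rangle=\frac{1}{2^n}\mathrm{Tr}(M)$. $P_A$ (resp. $P_D$) denotes a Pauli operator acting non-trivially only on subsystem $A$ (resp. $D$), i.e. equal to the identity on the other qubits, and $\mathrm{OTOC}(U)=\langle U^\dagger P_DUP_AU^\dagger P_DUP_A\rangle$. The average $\mathbb{E}_{P_A,P_D}$ is uniform over all Pauli operators on $A$ and all Pauli operators on $D$ (identity included). The OTOC magic of an $n$-qubit unitary $U$ is $$O_M(U)=\max_{P,Q\in\mathcal{P}_2^{\otimes n}}\Big[1-\big|\langle U^\dagger P U\, Q\, U^\dagger P U\, Q\rangle\big|\Big].$$ The decoding fidelity $F(U_{\mathrm{bh}})$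 is that of the teleportation-based decoding protocol for the Hayden–Preskill thought experiment, in which a state on $A$ is thrown into a black hole with dynamics $U_{\mathrm{bh}}$ and $D$ is the radiation emitted afterwards. It is determined by the average OTOC through $$\mathbb{E}_{P_A,P_D}\mathrm{OTOC}(U_{\mathrm{bh}})=\frac{1}{d_A^2\,F(U_{\mathrm{bh}})} .$$
   Formalization: The condition 1 − O_M(U_bh) − η > 0 is added: otherwise the right-hand side is negative or undefined while F > 0, and the bound fails (e.g. one qubit, A = D, U_bh the T gate: F = 1 but the right-hand side is −1/2). *)

theory Defs
  imports "HOL-Analysis.Analysis"
begin

text \<open>
  The qubits are the elements of a finite type \<open>'q\<close>, so \<open>n = CARD('q)\<close>.  The computational basis
  is indexed by bit strings \<open>'q \<Rightarrow> bool\<close>, a type with \<open>2 ^ n\<close> elements; a subsystem is a set of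
  qubits.
\<close>

type_synonym 'q qmat = "complex ^ ('q \<Rightarrow> bool) ^ ('q \<Rightarrow> bool)"

definition adj :: "complex ^ 'm ^ 'n \<Rightarrow> complex ^ 'n ^ 'm"
  where "adj M = (\<chi> i j. cnj (M $ j $ i))"

definition unitary :: "complex ^ 'n ^ 'n \<Rightarrow> bool"
  where "unitary U \<longleftrightarrow> adj U ** U = mat 1 \<and> U ** adj U = mat 1"

definition normalized_trace :: "('q::finite) qmat \<Rightarrow> complex"
  where "normalized_trace M = trace M / 2 ^ CARD('q)"

text \<open>Single-qubit basis states: \<open>False\<close> is \<open>|0\<rangle>\<close>, \<open>True\<close> is \<open>|1\<rangle>\<close>.\<close>

definition pauli_X :: "complex ^ bool ^ bool"
  where "pauli_X = (\<chi> i j. if i = j then 0 else 1)"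

definition pauli_Y :: "complex ^ bool ^ bool"
  where "pauli_Y = (\<chi> i j. if i = j then 0 else if i then \<i> else - \<i>)"

definition pauli_Z :: "complex ^ bool ^ bool"
  where "pauli_Z = (\<chi> i j. if i = j then (if i then - 1 else 1) else 0)"

definition single_paulis :: "(complex ^ bool ^ bool) set"
  where "single_paulis = {mat 1, pauli_X, pauli_Y, pauli_Z}"

text \<open>Entry \<open>(x, y)\<close> of a tensor product is the product of the entries \<open>(x q, y q)\<close> of its factors.\<close>

definition tensor :: "('q::finite \<Rightarrow> complex ^ bool ^ bool) \<Rightarrow> 'q qmat"
  where "tensor f = (\<chi> x y. \<Prod>q\<in>UNIV. f q $ x q $ y q)"

definition paulis :: "('q::finite) qmat set"
  where "paulis = tensor ` {f. \<forall>q. f q \<in> single_paulis}"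

definition paulis_on :: "('q::finite) set \<Rightarrow> 'q qmat set"
  where "paulis_on A = tensor ` {f. (\<forall>q. f q \<in> single_paulis) \<and> (\<forall>q. q \<notin> A \<longrightarrow> f q = mat 1)}"

text \<open>\<open>otoc U P Q\<close>: the first Pauli operator is the one evolved by \<open>U\<close>, so that the
  out-of-time-order correlator of \<open>P\<^sub>A\<close> and \<open>P\<^sub>D\<close> is \<open>otoc U P\<^sub>D P\<^sub>A\<close>.\<close>

definition otoc :: "('q::finite) qmat \<Rightarrow> 'q qmat \<Rightarrow> 'q qmat \<Rightarrow> complex"
  where "otoc U P Q = normalized_trace (adj U ** P ** U ** Q ** adj U ** P ** U ** Q)"

definition pauli_average ::
    "('q::finite) set \<Rightarrow> 'q set \<Rightarrow> ('q qmat \<Rightarrow> 'q qmat \<Rightarrow> 'a::field) \<Rightarrow> 'a"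
  where "pauli_average A D g =
    (\<Sum>PA\<in>paulis_on A. \<Sum>PD\<in>paulis_on D. g PA PD)
      / of_nat (card (paulis_on A) * card (paulis_on D))"

definition mean_otoc :: "('q::finite) set \<Rightarrow> 'q set \<Rightarrow> 'q qmat \<Rightarrow> complex"
  where "mean_otoc A D U = pauli_average A D (\<lambda>PA PD. otoc U PD PA)"

definition mean_abs_otoc :: "('q::finite) set \<Rightarrow> 'q set \<Rightarrow> 'q qmat \<Rightarrow> real"
  where "mean_abs_otoc A D U = pauli_average A D (\<lambda>PA PD. cmod (otoc U PD PA))"

definition otoc_magic :: "('q::finite) qmat \<Rightarrow> real"
  where "otoc_magic U = Max {1 - cmod (otoc U P Q) | P Q. P \<in> paulis \<and> Q \<in> paulis}"

definition sub_dim :: "('q::finite) set \<Rightarrow> real"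
  where "sub_dim A = 2 ^ card A"

text \<open>The fidelity \<open>F\<close> of teleportation-based Hayden-Preskill decoding is determined by
  \<open>mean_otoc A D U = 1 / (d\<^sub>A\<^sup>2 F)\<close>.  The lemma
  \<open>mean_otoc_eq_iff\<close> below shows that for unitary \<open>U\<close> this equation has exactly one
  real solution \<open>F\<close>, namely the following one; \<open>decoding_fidelity_pos\<close> shows that it is positive.\<close>

definition decoding_fidelity :: "('q::finite) set \<Rightarrow> 'q set \<Rightarrow> 'q qmat \<Rightarrow> real"
  where "decoding_fidelity A D U = 1 / ((sub_dim A)\<^sup>2 * Re (mean_otoc A D U))"


subsection \<open>Algebra of Pauli operators\<close>

lemma qsum_bool: "(\<Sum>b\<in>UNIV. f b) = f False + (f True :: 'a::comm_monoid_add)"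
  by (simp add: UNIV_bool)

lemma all_bool: "(\<forall>b. P b) \<longleftrightarrow> P False \<and> P True"
  by (metis (full_types))

lemmas single_defs = single_paulis_def pauli_X_def pauli_Y_def pauli_Z_def

lemma single_adj: "a \<in> single_paulis \<Longrightarrow> adj a = a"
  by (auto simp: single_defs adj_def vec_eq_iff mat_def)

lemma single_square: "a \<in> single_paulis \<Longrightarrow> a ** a = mat 1"
  by (auto simp: single_defs vec_eq_iff mat_def matrix_matrix_mult_def qsum_bool)

lemma single_trace:
  "a \<in> single_paulis \<Longrightarrow> b \<in> single_paulis \<Longrightarrow> a \<noteq> b \<Longrightarrow> trace (a ** b) = 0"
  unfolding single_paulis_def
  by (elim insertE emptyE; simp add: single_defs mat_def matrix_matrix_mult_def qsum_bool trace_def)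

lemma single_mult_witness:
  assumes "c \<noteq> 0" "cmod c = 1" "r \<in> single_paulis"
    "\<forall>i j. (a ** b) $ i $ j = c * r $ i $ j"
  shows "\<exists>c r. cmod c = 1 \<and> r \<in> single_paulis \<and> (\<forall>i j. (a ** b) $ i $ j = c * r $ i $ j)"
  using assms by blast

lemma single_mult:
  assumes "a \<in> single_paulis" "b \<in> single_paulis"
  shows "\<exists>c r. cmod c = 1 \<and> r \<in> single_paulis \<and> (\<forall>i j. (a ** b) $ i $ j = c * r $ i $ j)"
proof -
  note d = single_defs mat_def matrix_matrix_mult_def qsum_bool all_bool
  have 1: "mat 1 \<in> single_paulis" "pauli_X \<in> single_paulis" "pauli_Y \<in> single_paulis"
    "pauli_Z \<in> single_paulis" by (auto simp: single_paulis_def)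
  consider "a = mat 1" | "b = mat 1" | "a = b"
    | "a = pauli_X" "b = pauli_Y" | "a = pauli_Y" "b = pauli_X"
    | "a = pauli_Y" "b = pauli_Z" | "a = pauli_Z" "b = pauli_Y"
    | "a = pauli_Z" "b = pauli_X" | "a = pauli_X" "b = pauli_Z"
    using assms by (auto simp: single_paulis_def)
  then show ?thesis
  proof cases
    case 1 then show ?thesis using assms by (intro single_mult_witness[of 1 b]) auto
  next
    case 2 then show ?thesis using assms by (intro single_mult_witness[of 1 a]) auto
  next
    case 3 then show ?thesis using assms 1
      by (intro single_mult_witness[of 1 "mat 1"]) (auto simp: single_square)
  next
    case 4 then show ?thesis using 1 by (intro single_mult_witness[of \<i> pauli_Z]) (auto simp: d)
  next
    case 5 then show ?thesis using 1 by (intro single_mult_witness[of "-\<i>" pauli_Z]) (auto simp: d)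
  next
    case 6 then show ?thesis using 1 by (intro single_mult_witness[of \<i> pauli_X]) (auto simp: d)
  next
    case 7 then show ?thesis using 1 by (intro single_mult_witness[of "-\<i>" pauli_X]) (auto simp: d)
  next
    case 8 then show ?thesis using 1 by (intro single_mult_witness[of \<i> pauli_Y]) (auto simp: d)
  next
    case 9 then show ?thesis using 1 by (intro single_mult_witness[of "-\<i>" pauli_Y]) (auto simp: d)
  qed
qed

lemma prod_sum_fun:
  fixes h :: "'q::finite \<Rightarrow> bool \<Rightarrow> complex"
  shows "(\<Prod>q\<in>UNIV. \<Sum>b\<in>UNIV. h q b) = (\<Sum>z\<in>UNIV. \<Prod>q\<in>UNIV. h q (z q))"
  by (subst prod_sum_PiE) (auto simp: PiE_UNIV_domain Pi_def)

lemma tensor_mult: "tensor f ** tensor g = tensor (\<lambda>q. f q ** g q)"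
  by (simp add: tensor_def matrix_matrix_mult_def vec_eq_iff prod_sum_fun prod.distrib)

lemma trace_tensor: "trace (tensor f) = (\<Prod>q\<in>UNIV. trace (f q))"
  by (simp add: tensor_def trace_def prod_sum_fun)

lemma tensor_one: "tensor (\<lambda>q. mat 1) = mat 1"
  by (auto simp: tensor_def mat_def vec_eq_iff fun_eq_iff)

lemma adj_mult: "adj (M ** N) = adj N ** adj M"
  by (simp add: adj_def matrix_matrix_mult_def vec_eq_iff mult.commute)

lemma adj_tensor: "adj (tensor f) = tensor (\<lambda>q. adj (f q))"
  by (simp add: adj_def tensor_def vec_eq_iff)

lemma adj_adj: "adj (adj M) = M"
  by (simp add: adj_def vec_eq_iff)

lemma finite_single: "finite single_paulis"
  by (simp add: single_paulis_def)

lemma finite_paulis: "finite (paulis :: ('q::finite) qmat set)"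
proof -
  have "finite {f::'q \<Rightarrow> _. \<forall>q. q \<in> UNIV \<longrightarrow> f q \<in> single_paulis}"
    using finite_PiE[of "UNIV::'q set" "\<lambda>_. single_paulis"] finite_single
    by (simp add: PiE_UNIV_domain Pi_def)
  then show ?thesis by (simp add: paulis_def)
qed

lemma paulis_on_subset: "paulis_on A \<subseteq> paulis"
  by (auto simp: paulis_on_def paulis_def)

lemma finite_paulis_on: "finite (paulis_on A)"
  using paulis_on_subset finite_paulis finite_subset by blast

lemma one_in_paulis_on: "mat 1 \<in> paulis_on A"
proof -
  have "tensor (\<lambda>q. mat 1) \<in> paulis_on A"
    unfolding paulis_on_def by (rule imageI) (auto simp: single_paulis_def)
  then show ?thesis by (simp add: tensor_one)
qed

lemma card_paulis_on_pos: "card (paulis_on A) > 0"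
  using finite_paulis_on one_in_paulis_on by (metis card_gt_0_iff empty_iff)

lemma paulis_adj: "P \<in> paulis \<Longrightarrow> adj P = P"
  by (auto simp: paulis_def adj_tensor single_adj)

lemma paulis_square: "P \<in> paulis \<Longrightarrow> P ** P = mat 1"
  by (auto simp: paulis_def tensor_mult single_square tensor_one)

lemma paulis_on_mult:
  assumes "P \<in> paulis_on A" "Q \<in> paulis_on A"
  shows "\<exists>R\<in>paulis_on A. \<exists>c. cmod c = 1 \<and> (\<forall>x y. (P ** Q) $ x $ y = c * R $ x $ y)"
proof -
  obtain f where f: "P = tensor f" "\<And>q. f q \<in> single_paulis" "\<And>q. q \<notin> A \<Longrightarrow> f q = mat 1"
    using assms(1) by (auto simp: paulis_on_def)
  obtain g where g: "Q = tensor g" "\<And>q. g q \<in> single_paulis" "\<And>q. q \<notin> A \<Longrightarrow> g q = mat 1"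
    using assms(2) by (auto simp: paulis_on_def)
  have "\<forall>q. \<exists>c r. cmod c = 1 \<and> r \<in> single_paulis \<and> (q \<notin> A \<longrightarrow> r = mat 1) \<and>
      (\<forall>i j. (f q ** g q) $ i $ j = c * r $ i $ j)" (is "\<forall>q. ?T q")
  proof
    fix q
    show "?T q"
    proof (cases "q \<in> A")
      case True
      then show ?thesis using single_mult[OF f(2) g(2), of q q] by auto
    next
      case False
      then show ?thesis using f(3) g(3)
        by (intro exI[of _ 1] exI[of _ "mat 1"]) (auto simp: single_paulis_def)
    qed
  qed
  then obtain c r where cr: "\<And>q. cmod (c q) = 1" "\<And>q. r q \<in> single_paulis"
      "\<And>q. q \<notin> A \<Longrightarrow> r q = mat 1" "\<And>q i j. (f q ** g q) $ i $ j = c q * r q $ i $ j"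
    by metis
  have "tensor r \<in> paulis_on A" using cr by (auto simp: paulis_on_def)
  moreover have "(P ** Q) $ x $ y = (\<Prod>q\<in>UNIV. c q) * tensor r $ x $ y" for x y
    by (simp add: f g tensor_mult) (simp add: tensor_def cr prod.distrib)
  moreover have "cmod (\<Prod>q\<in>UNIV. c q) = 1" by (simp add: prod_norm[symmetric] cr)
  ultimately show ?thesis by blast
qed

lemma paulis_proportional:
  fixes P Q :: "('q::finite) qmat"
  assumes "P \<in> paulis" "Q \<in> paulis" "c \<noteq> 0" "\<forall>x y. P $ x $ y = c * Q $ x $ y"
  shows "P = Q"
proof -
  obtain f where f: "P = tensor f" "\<And>q. f q \<in> single_paulis"
    using assms(1) by (auto simp: paulis_def)
  obtain g where g: "Q = tensor g" "\<And>q. g q \<in> single_paulis"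
    using assms(2) by (auto simp: paulis_def)
  have "trace (P ** Q) = c * trace (Q ** Q)"
    using assms(4) by (simp add: trace_def matrix_matrix_mult_def sum_distrib_left mult.assoc)
  also have "trace (Q ** Q) = of_nat CARD('q \<Rightarrow> bool)"
    by (simp add: paulis_square[OF assms(2)] trace_def mat_def)
  finally have "trace (P ** Q) \<noteq> 0" using assms(3) by simp
  then have "trace (f q ** g q) \<noteq> 0" for q
    by (simp add: f g tensor_mult trace_tensor)
  then have "f = g" using single_trace f(2) g(2) by blast
  then show ?thesis by (simp add: f g)
qed


subsection \<open>The relation between the average correlator and the decoding fidelity\<close>

lemma trace_hermitian_square:
  assumes "adj W = W"
  shows "trace (W ** W) = of_real (\<Sum>x\<in>UNIV. \<Sum>y\<in>UNIV. (cmod (W $ x $ y))\<^sup>2)"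
proof -
  have "W $ x $ y * W $ y $ x = of_real ((cmod (W $ x $ y))\<^sup>2)" for x y
  proof -
    have "adj W $ y $ x = cnj (W $ x $ y)" by (simp add: adj_def)
    then have "W $ y $ x = cnj (W $ x $ y)" by (subst (asm) assms)
    then have "W $ x $ y * W $ y $ x = W $ x $ y * cnj (W $ x $ y)" by (rule arg_cong)
    also have "\<dots> = of_real ((cmod (W $ x $ y))\<^sup>2)" by (rule complex_norm_square[symmetric])
    finally show ?thesis .
  qed
  then show ?thesis unfolding trace_def matrix_matrix_mult_def by simp
qed

lemma matrix_sum_mult:
  fixes M :: "'i \<Rightarrow> complex ^ 'n ^ 'n"
  shows "(\<Sum>i\<in>S. M i) ** N = (\<Sum>i\<in>S. M i ** N)"
    and "N ** (\<Sum>i\<in>S. M i) = (\<Sum>i\<in>S. N ** M i)"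
  by (simp_all add: matrix_matrix_mult_def vec_eq_iff sum_distrib_left sum_distrib_right)
    (rule allI, rule allI, rule sum.swap)+

lemma trace_sum: "trace (\<Sum>i\<in>S. M i) = (\<Sum>i\<in>S. trace (M i :: complex ^ 'n ^ 'n))"
  unfolding trace_def sum_component by (rule sum.swap)

lemma adj_sum: "adj (\<Sum>i\<in>S. M i) = (\<Sum>i\<in>S. adj (M i))"
  by (simp add: adj_def vec_eq_iff)

lemma twirl_nonneg:
  fixes V :: "('q::finite) qmat"
  assumes V: "adj V = V"
  shows "\<exists>r\<ge>0. (\<Sum>P\<in>paulis_on A. trace (V ** P ** V ** P)) = of_real r"
proof -
  let ?S = "paulis_on A"
  let ?t = "\<lambda>P. trace (V ** P ** V ** P)"
  define W where "W = (\<Sum>P\<in>?S. P ** V ** P)"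
  have herm: "adj P = P" if "P \<in> ?S" for P
    using that paulis_adj paulis_on_subset by blast
  have "adj W = W"
    unfolding W_def adj_sum
    by (intro sum.cong refl) (simp add: adj_mult herm V matrix_mul_assoc)
  define r where "r = (\<Sum>x\<in>UNIV. \<Sum>y\<in>UNIV. (cmod (W $ x $ y))\<^sup>2)"
  have r: "r \<ge> 0" "trace (W ** W) = of_real r"
    unfolding r_def trace_hermitian_square[OF \<open>adj W = W\<close>]
    by (intro sum_nonneg zero_le_power2) (rule refl)
  have "trace (W ** W) = (\<Sum>P\<in>?S. \<Sum>Q\<in>?S. trace ((P ** V ** P) ** (Q ** V ** Q)))"
    by (simp add: W_def matrix_sum_mult trace_sum) (rule sum.swap)
  also have "\<dots> = (\<Sum>P\<in>?S. \<Sum>Q\<in>?S. ?t Q)"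
  proof (rule sum.cong[OF refl])
    fix P assume P: "P \<in> ?S"
    define h where "h Q = (SOME R. R \<in> ?S \<and>
      (\<exists>c. cmod c = 1 \<and> (\<forall>x y. (P ** Q) $ x $ y = c * R $ x $ y)))" for Q
    have h: "h Q \<in> ?S" "\<exists>c. cmod c = 1 \<and> (\<forall>x y. (P ** Q) $ x $ y = c * h Q $ x $ y)"
      if "Q \<in> ?S" for Q
      using someI_ex[OF paulis_on_mult[OF P that, unfolded Bex_def]] unfolding h_def by blast+
    have inj: "inj_on h ?S"
    proof (rule inj_onI)
      fix Q Q' assume Q: "Q \<in> ?S" and Q': "Q' \<in> ?S" and eq: "h Q = h Q'"
      obtain c where c: "cmod c = 1" "\<And>x y. (P ** Q) $ x $ y = c * h Q $ x $ y"
        using h(2)[OF Q] by blast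
      obtain d where d: "cmod d = 1" "\<And>x y. (P ** Q') $ x $ y = d * h Q $ x $ y"
        using h(2)[OF Q'] eq by metis
      have nz: "c \<noteq> 0" "d \<noteq> 0" using c(1) d(1) by auto
      have pq: "(P ** Q) $ x $ y = (c / d) * (P ** Q') $ x $ y" for x y
        using nz by (simp add: c d)
      have PP: "P ** P = mat 1" using P paulis_square paulis_on_subset by blast
      have "Q $ x $ y = (c / d) * Q' $ x $ y" for x y
      proof -
        have "Q $ x $ y = (P ** (P ** Q)) $ x $ y" by (simp add: matrix_mul_assoc PP)
        also have "\<dots> = (\<Sum>z\<in>UNIV. P $ x $ z * (P ** Q) $ z $ y)"
          by (simp add: matrix_matrix_mult_def)
        also have "\<dots> = (c / d) * (\<Sum>z\<in>UNIV. P $ x $ z * (P ** Q') $ z $ y)"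
          unfolding pq by (simp add: sum_distrib_left algebra_simps)
        also have "(\<Sum>z\<in>UNIV. P $ x $ z * (P ** Q') $ z $ y) = (P ** (P ** Q')) $ x $ y"
          by (simp add: matrix_matrix_mult_def)
        also have "\<dots> = Q' $ x $ y" by (simp add: matrix_mul_assoc PP)
        finally show ?thesis .
      qed
      then show "Q = Q'"
        using paulis_proportional[of Q Q' "c / d"] Q Q' paulis_on_subset nz by auto
    qed
    have "h ` ?S = ?S"
      using inj h(1) finite_paulis_on by (metis endo_inj_surj image_subsetI)
    have "trace ((P ** V ** P) ** (Q ** V ** Q)) = ?t (h Q)" if Q: "Q \<in> ?S" for Q
    proof -
      obtain c where c: "cmod c = 1" "\<And>x y. (P ** Q) $ x $ y = c * h Q $ x $ y"
        using h(2)[OF Q] by blast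
      have pq: "P ** Q = (\<chi> x y. c * h Q $ x $ y)" by (simp add: vec_eq_iff c)
      have "Q ** P = adj (P ** Q)" using P Q by (simp add: adj_mult herm)
      also have "\<dots> = (\<chi> x y. cnj c * adj (h Q) $ x $ y)"
        unfolding pq by (simp add: adj_def)
      finally have qp: "Q ** P = (\<chi> x y. cnj c * h Q $ x $ y)" by (simp add: herm h Q)
      have cc: "cnj c * c = 1"
        using c(1) by (metis complex_norm_square mult.commute of_real_1 power_one)
      have scal: "M ** (\<chi> x y. k * N $ x $ y) = (\<chi> x y. k * (M ** N) $ x $ y)"
        "(\<chi> x y. k * N $ x $ y) ** M = (\<chi> x y. k * (N ** M) $ x $ y)"
        for k and M N :: "'q qmat"
        by (simp_all add: matrix_matrix_mult_def vec_eq_iff sum_distrib_left algebra_simps)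
      have "trace ((P ** V ** P) ** (Q ** V ** Q)) = trace (P ** (V ** P ** Q ** V ** Q))"
        by (simp add: matrix_mul_assoc)
      also have "\<dots> = trace (V ** P ** Q ** V ** Q ** P)"
        by (rule trace_mul_sym)
      also have "\<dots> = trace (V ** (P ** Q) ** (V ** (Q ** P)))"
        by (simp add: matrix_mul_assoc)
      also have "\<dots> = trace (\<chi> x y. (cnj c * c) * (V ** h Q ** (V ** h Q)) $ x $ y)"
        unfolding pq qp scal by (simp add: mult.assoc)
      also have "\<dots> = ?t (h Q)" by (simp add: cc matrix_mul_assoc)
      finally show ?thesis .
    qed
    then have "(\<Sum>Q\<in>?S. trace ((P ** V ** P) ** (Q ** V ** Q))) = (\<Sum>Q\<in>?S. ?t (h Q))"
      by simp
    also have "\<dots> = (\<Sum>Q\<in>h ` ?S. ?t Q)" by (simp add: sum.reindex[OF inj])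
    finally show "(\<Sum>Q\<in>?S. trace ((P ** V ** P) ** (Q ** V ** Q))) = (\<Sum>Q\<in>?S. ?t Q)"
      by (simp add: \<open>h ` ?S = ?S\<close>)
  qed
  finally have eq: "of_real r = of_nat (card ?S) * (\<Sum>Q\<in>?S. ?t Q)" by (simp add: r)
  have "card ?S \<noteq> 0" using card_paulis_on_pos[of A] by simp
  then have "(\<Sum>Q\<in>?S. ?t Q) = of_real (r / real (card ?S))"
    using eq by (simp add: field_simps)
  then show ?thesis using r(1) by (metis divide_nonneg_nonneg of_nat_0_le_iff)
qed

lemma mean_otoc_pos:
  fixes U :: "('q::finite) qmat"
  assumes "unitary U"
  shows "\<exists>e>0. mean_otoc A D U = of_real e"
proof -
  let ?t = "\<lambda>P. \<Sum>Q\<in>paulis_on A. otoc U P Q"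
  have nonneg: "\<exists>r\<ge>0. ?t P = of_real r" if P: "P \<in> paulis_on D" for P
  proof -
    define V where "V = adj U ** P ** U"
    have "adj P = P" using P paulis_adj paulis_on_subset by blast
    then have "adj V = V" by (simp add: V_def adj_mult adj_adj matrix_mul_assoc)
    then obtain r where "r \<ge> 0" "(\<Sum>Q\<in>paulis_on A. trace (V ** Q ** V ** Q)) = of_real r"
      using twirl_nonneg by blast
    moreover have "?t P = (\<Sum>Q\<in>paulis_on A. trace (V ** Q ** V ** Q)) / 2 ^ CARD('q)"
      by (simp add: otoc_def normalized_trace_def V_def matrix_mul_assoc sum_divide_distrib)
    ultimately show ?thesis
      by (intro exI[of _ "r / 2 ^ CARD('q)"]) simp
  qed
  have "otoc U (mat 1) Q = 1" if "Q \<in> paulis_on A" for Q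
  proof -
    have U: "adj U ** U = mat 1" using assms by (simp add: unitary_def)
    have QQ: "Q ** Q = mat 1" using that paulis_square paulis_on_subset by blast
    have "adj U ** mat 1 ** U ** Q ** adj U ** mat 1 ** U ** Q
        = (adj U ** U) ** Q ** (adj U ** U) ** Q" by (simp add: matrix_mul_assoc)
    also have "\<dots> = mat 1" by (simp add: U QQ)
    finally show ?thesis
      by (simp add: otoc_def normalized_trace_def trace_def mat_def card_fun)
  qed
  then have one: "?t (mat 1) = of_nat (card (paulis_on A))" by simp
  obtain r where r: "\<And>P. P \<in> paulis_on D \<Longrightarrow> r P \<ge> 0 \<and> ?t P = complex_of_real (r P)"
    using nonneg by metis
  have cA: "card (paulis_on A) > 0" and cD: "card (paulis_on D) > 0"
    by (rule card_paulis_on_pos)+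
  have "complex_of_real (r (mat 1)) = of_real (real (card (paulis_on A)))"
    using r[OF one_in_paulis_on] one by simp
  then have "r (mat 1) > 0" using cA by (simp only: of_real_eq_iff of_nat_0_less_iff)
  then have pos: "sum r (paulis_on D) > 0"
    using r one_in_paulis_on finite_paulis_on by (metis sum_pos2)
  have "(\<Sum>PA\<in>paulis_on A. \<Sum>PD\<in>paulis_on D. otoc U PD PA) = (\<Sum>PD\<in>paulis_on D. ?t PD)"
    by (rule sum.swap)
  also have "\<dots> = of_real (sum r (paulis_on D))" using r by simp
  finally have "mean_otoc A D U =
      of_real (sum r (paulis_on D) / real (card (paulis_on A) * card (paulis_on D)))"
    by (simp add: mean_otoc_def pauli_average_def)
  moreover have "sum r (paulis_on D) / real (card (paulis_on A) * card (paulis_on D)) > 0"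
    using pos cA cD by simp
  ultimately show ?thesis by blast
qed

lemma decoding_fidelity_pos:
  assumes "unitary U"
  shows "decoding_fidelity A D U > 0"
  using mean_otoc_pos[OF assms, of A D] by (auto simp: decoding_fidelity_def sub_dim_def)

lemma mean_otoc_eq_iff:
  assumes "unitary U"
  shows "mean_otoc A D U = of_real (1 / ((sub_dim A)\<^sup>2 * F)) \<longleftrightarrow> F = decoding_fidelity A D U"
proof -
  obtain e where e: "e > 0" "mean_otoc A D U = of_real e"
    using mean_otoc_pos[OF assms] by blast
  have d: "(sub_dim A)\<^sup>2 > 0" by (simp add: sub_dim_def)
  have "mean_otoc A D U = of_real (1 / ((sub_dim A)\<^sup>2 * F)) \<longleftrightarrow> e = 1 / ((sub_dim A)\<^sup>2 * F)"
    by (simp only: e of_real_eq_iff)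
  also have "\<dots> \<longleftrightarrow> F = 1 / ((sub_dim A)\<^sup>2 * e)"
    using e(1) d by (cases "F = 0") (auto simp: field_simps)
  finally show ?thesis by (simp add: decoding_fidelity_def e)
qed

end

theory Submission
  imports Defs
begin

text \<open>The OTOC magic is a maximum over all Pauli pairs, so every single correlator has modulus
  at least \<open>1 - otoc_magic U\<close> (\<open>cmod_otoc_ge\<close>). A uniform average inherits
  this bound (\<open>pauli_average_ge\<close>), and subtracting \<eta> turns it into a lower bound
  on the mean OTOC. The fidelity is inversely proportional to that mean, so it is bounded
  above.\<close>

lemma cmod_otoc_ge:
  fixes U :: "('q::finite) qmat"
  assumes "P \<in> paulis" "Q \<in> paulis"
  shows "1 - otoc_magic U \<le> cmod (otoc U P Q)"
proof -
  let ?S = "{1 - cmod (otoc U P Q) | P Q. P \<in> paulis \<and> Q \<in> paulis}"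
  \<comment> \<open>As the image of a finite product, the set is finite, so \<open>Max\<close> is a
    genuine upper bound.\<close>
  have "?S = (\<lambda>(P, Q). 1 - cmod (otoc U P Q)) ` (paulis \<times> paulis)"
    by auto
  then have "finite ?S"
    by (simp add: finite_paulis)
  moreover have "1 - cmod (otoc U P Q) \<in> ?S"
    using assms by blast
  ultimately have "1 - cmod (otoc U P Q) \<le> otoc_magic U"
    unfolding otoc_magic_def by (rule Max_ge)
  then show ?thesis by simp
qed

lemma pauli_average_ge:
  fixes g :: "('q::finite) qmat \<Rightarrow> 'q qmat \<Rightarrow> real"
  assumes "\<And>PA PD. PA \<in> paulis_on A \<Longrightarrow> PD \<in> paulis_on D \<Longrightarrow> c \<le> g PA PD"
  shows "c \<le> pauli_average A D g"
proof -
  have "real (card (paulis_on A)) * (real (card (paulis_on D)) * c)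
      \<le> (\<Sum>PA\<in>paulis_on A. \<Sum>PD\<in>paulis_on D. g PA PD)"
    by (intro sum_bounded_below assms)
  then show ?thesis
    \<comment> \<open>Both cardinalities are positive, so the average does not divide by
      zero.\<close>
    using card_paulis_on_pos[of A] card_paulis_on_pos[of D]
    by (simp add: pauli_average_def pos_le_divide_eq mult_ac)
qed

lemma mean_abs_otoc_ge: "1 - otoc_magic U \<le> mean_abs_otoc A D U"
  unfolding mean_abs_otoc_def
  by (intro pauli_average_ge cmod_otoc_ge) (use paulis_on_subset in blast)+

theorem theorem2:
  fixes U :: "('q::finite) qmat" and A D :: "'q set" and \<eta> :: real
  assumes "unitary U"
    and "\<eta> > 0"
    and "complex_of_real (mean_abs_otoc A D U) = mean_otoc A D U + complex_of_real \<eta>"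
    and "1 - otoc_magic U - \<eta> > 0"
  shows "decoding_fidelity A D U \<le> 1 / ((sub_dim A)\<^sup>2 * (1 - otoc_magic U - \<eta>))"
proof -
  have "mean_abs_otoc A D U = Re (mean_otoc A D U) + \<eta>"
    using arg_cong[OF assms(3), of Re] by simp
  then have "1 - otoc_magic U - \<eta> \<le> Re (mean_otoc A D U)"
    using mean_abs_otoc_ge[of U A D] by simp
  moreover have "(sub_dim A)\<^sup>2 > 0"
    by (simp add: sub_dim_def)
  ultimately show ?thesis
    \<comment> \<open>Positivity of \<open>1 - otoc_magic U - \<eta>\<close> makes both denominators
      positive, so taking reciprocals reverses the inequality. Otherwise the right side would be at
      most 0 (division by zero gives 0), below the positive fidelity.\<close>
    unfolding decoding_fidelity_def using assms(4)
    by (intro divide_left_mono mult_left_mono mult_pos_pos) auto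
qed

end
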